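(* Let $\mathcal{U}=\{C_1,\ldots,C_s\}$ be a finite collection of connected graphs and let $\mathcal{G}_\mathcal{U}\subseteq[0,1]^s$ be its graph profile. Then $$\operatorname{trop}(\mathcal{G}_\mathcal{U})=\operatorname{cl}(\operatorname{cone}(\log(\mathcal{G}_\mathcal{U})))=\operatorname{cl}(\operatorname{conv}(\log(\mathcal{G}_\mathcal{U})))\subseteq\mathbb{R}^s_{\le 0}.$$ Further, for any $\epsilon>0$, $\operatorname{trop}(\mathcal{G}_\mathcal{U})$ is determined by the nonempty neighborhood $\mathcal{G}_\mathcal{U}\cap B(\mathbf{0},\epsilon)$, where $B(\mathbf{0},\epsilon)$ is the ball with center $\mathbf 0$ and radius $\epsilon$ (i.e., for $\mathbf a,\mathbf b\in\mathbb{R}^s$, the inequality $\mathbf a^\top\mathbf y\ge\mathbf b^\top\mathbf y$ holds for all $\mathbf y\in\operatorname{trop}(\mathcal{G}_\mathcal{U})$ if and only if it holds for all $\mathbf y\in\log(\mathcal{G}_\mathcal{U}\cap B(\mathbf 0,\epsilon))$).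
   Context: Graphs are finite and simple. For graphs $H,G$, the homomorphism density $t(H;G)$ is the probability that a uniformly random map $V(H)\to V(G)$ sends every edge of $H$ to an edge of $G$. The graph profile $\mathcal{G}_\mathcal{U}$ of $\mathcal{U}=\{C_1,\dots,C_s\}$ is the closure of the set of vectors $(t(C_1;G),\ldots,t(C_s;G))$ as $G$ ranges over all graphs. For $\mathcal S\subseteq\mathbb{R}^s_{\ge0}$, $\log(\mathcal S)$ denotes the image of $\mathcal S\cap\mathbb{R}^s_{>0}$ under $\mathbf v\mapsto(\log_e v_1,\ldots,\log_e v_s)$. The tropicalization (logarithmic limit set) $\operatorname{trop}(\mathcal S)$ is the set of $\mathbf y\in\mathbb{R}^s$ for which there exist $\tau_k\in(0,1)$ with $\tau_k\to0$ and $\mathbf y(k)\in\mathcal S\cap\mathbb{R}^s_{>0}$ with $\frac{-1}{\log_e\tau_k}\log(\mathbf y(k))\to\mathbf y$. $\operatorname{cone}$ and $\operatorname{conv}$ denote conical and convex hull, $\operatorname{cl}$ closure.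
   Formalization: The neighborhood is shown nonempty for every ε when each C_i has an edge, and the equivalence is stated for those ε for which the neighborhood is nonempty; if some C_i is a single vertex, its density is always 1 and the neighborhood is empty for ε ≤ 1. *)

theory Defs
  imports "HOL-Analysis.Analysis" "Graph_Theory.Pair_Digraph" "Graph_Theory.Digraph_Component"
begin

text \<open>
  A finite simple graph is a \<^term>\<open>pair_graph\<close>: finite vertex set, irreflexive symmetric set of
  arcs, each undirected edge appearing as two opposite arcs. Since the arc sets are symmetric,
  preserving arcs is the same as preserving edges.
\<close>

definition graph_homs :: "'a pair_pre_digraph \<Rightarrow> 'b pair_pre_digraph \<Rightarrow> ('a \<Rightarrow> 'b) set" where
  "graph_homs H G =
     {f \<in> pverts H \<rightarrow>\<^sub>E pverts G. \<forall>(u, v) \<in> parcs H. (f u, f v) \<in> parcs G}"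

definition hom_density :: "'a pair_pre_digraph \<Rightarrow> 'b pair_pre_digraph \<Rightarrow> real" where
  "hom_density H G = real (card (graph_homs H G)) / real (card (pverts H \<rightarrow>\<^sub>E pverts G))"

text \<open>
  Every finite graph has an isomorphic copy with vertices in \<^typ>\<open>nat\<close>, so it suffices to let the
  target graph range over those. The graph without vertices is excluded: there is no uniformly
  random map into it.
\<close>

definition graph_profile :: "('n::finite \<Rightarrow> 'a pair_pre_digraph) \<Rightarrow> (real ^ 'n) set" where
  "graph_profile C =
     closure {(\<chi> i. hom_density (C i) G) | G :: nat pair_pre_digraph.
                pair_graph G \<and> pverts G \<noteq> {}}"

definition pos_orthant :: "(real ^ 'n::finite) set" where
  "pos_orthant = {v. \<forall>i. v $ i > 0}"

definition log_vec :: "real ^ 'n::finite \<Rightarrow> real ^ 'n" where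
  "log_vec v = (\<chi> i. ln (v $ i))"

definition log_set :: "(real ^ 'n::finite) set \<Rightarrow> (real ^ 'n) set" where
  "log_set S = log_vec ` (S \<inter> pos_orthant)"

definition trop :: "(real ^ 'n::finite) set \<Rightarrow> (real ^ 'n) set" where
  "trop S = {y. \<exists>(\<tau> :: nat \<Rightarrow> real) (Y :: nat \<Rightarrow> real ^ 'n).
               (\<forall>k. 0 < \<tau> k \<and> \<tau> k < 1) \<and> \<tau> \<longlonglongrightarrow> 0 \<and>
               (\<forall>k. Y k \<in> S \<inter> pos_orthant) \<and>
               (\<lambda>k. (- 1 / ln (\<tau> k)) *\<^sub>R log_vec (Y k)) \<longlonglongrightarrow> y}"

text \<open>
  The conical hull (all nonnegative linear combinations) is the library's
  \<^term>\<open>\<lambda>S. convex_cone hull S\<close>. Note that \<^term>\<open>\<lambda>S. cone hull S\<close> would only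
  close under nonnegative scaling.
\<close>

end

theory Submission
  imports Defs
begin

text \<open>
  Homomorphism densities are multiplicative in the tensor product of the target graphs, and the
  complete graphs \<open>K\<^sub>n\<close> have densities tending to 1. So the profile \<open>S\<close> is closed under
  coordinatewise multiplication and contains the all-ones vector, i.e. \<open>log S\<close> is an additive
  monoid. The convex hull of an additive monoid is already a convex cone. It is contained in
  the closed set \<open>trop S\<close> because \<open>\<sigma> \<lfloor>1/\<sigma>\<rfloor> y\<close> tends to \<open>y\<close> as \<open>\<sigma>\<close> tends to 0.

  For the second part, powers of the density vector of a large \<open>K\<^sub>n\<close> yield a positive vector
  \<open>w\<close> of the profile inside the ball. Then \<open>v\<^sup>k w\<close> also lies in the ball for all \<open>k\<close> and all
  \<open>v\<close> in the profile, and a linear inequality valid at \<open>k log v + log w\<close> for all \<open>k\<close> is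
  valid at \<open>log v\<close>.
\<close>

section \<open>Additive monoids in a normed space\<close>

text \<open>Convex hulls commute with Minkowski sums and \<open>L + L \<subseteq> L\<close>, so the
  hull is closed under addition and hence under natural multiples. For \<open>n > c \<ge> 0\<close>
  the point \<open>c *\<^sub>R x\<close> lies on the segment from 0 to
  \<open>real n *\<^sub>R x\<close>.\<close>

lemma convex_cone_hull_eq_convex_hull:
  fixes L :: "'a::real_vector set"
  assumes zero: "0 \<in> L" and add: "\<And>x y. x \<in> L \<Longrightarrow> y \<in> L \<Longrightarrow> x + y \<in> L"
  shows "convex_cone hull L = convex hull L"
proof
  let ?H = "convex hull L"
  have sum: "x + y \<in> ?H" if "x \<in> ?H" "y \<in> ?H" for x y
  proof -
    have "x + y \<in> convex hull (L + L)"
      using that by (auto simp: convex_hull_set_plus intro: set_plus_intro)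
    moreover have "L + L \<subseteq> L"
      using add by (auto elim: set_plus_elim)
    ultimately show ?thesis
      using hull_mono by blast
  qed
  have zeroH: "0 \<in> ?H"
    using zero by (rule hull_inc)
  have nat: "real n *\<^sub>R x \<in> ?H" if "x \<in> ?H" for n x
    using that by (induction n) (auto simp: zeroH scaleR_left_distrib intro: sum)
  have "c *\<^sub>R x \<in> ?H" if x: "x \<in> ?H" and "c \<ge> 0" for c x
  proof -
    obtain n where n: "c < real n"
      using reals_Archimedean2 by blast
    hence "n > 0"
      using that(2) by (cases n) auto
    have "(1 - c / n) *\<^sub>R 0 + (c / n) *\<^sub>R (real n *\<^sub>R x) \<in> ?H"
      using n \<open>c \<ge> 0\<close> by (intro convexD_alt convex_convex_hull zeroH nat x) auto
    thus ?thesis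
      using \<open>n > 0\<close> by simp
  qed
  hence "convex_cone ?H"
    using sum zeroH by (simp add: convex_cone_iff)
  thus "convex_cone hull L \<subseteq> ?H"
    by (intro hull_minimal hull_subset)
qed (rule convex_hull_subset_convex_cone_hull)

text \<open>The lower Kuratowski limit of the sets \<sigma>\<open>L\<close> as \<sigma> decreases to
  0. Unlike \<open>trop\<close>, which asks for approximants along some sequence, it asks for them
  at all small \<sigma>. Two of its points can thus be approximated at the same \<sigma> and
  added.\<close>

definition asymptotic_multiples :: "'a::real_normed_vector set \<Rightarrow> 'a set" where
  "asymptotic_multiples L =
     {y. \<forall>e>0. \<forall>\<^sub>F \<sigma> in at_right 0. \<exists>x\<in>L. dist (\<sigma> *\<^sub>R x) y < e}"

lemma closed_asymptotic_multiples: "closed (asymptotic_multiples L)"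
  unfolding closed_sequential_limits
proof (intro allI impI)
  fix Y l
  assume "(\<forall>n. Y n \<in> asymptotic_multiples L) \<and> Y \<longlonglongrightarrow> l"
  hence Y: "Y n \<in> asymptotic_multiples L" and lim: "Y \<longlonglongrightarrow> l" for n
    by auto
  show "l \<in> asymptotic_multiples L"
    unfolding asymptotic_multiples_def
  proof (intro CollectI allI impI)
    fix e :: real assume "e > 0"
    then obtain n where n: "dist (Y n) l < e / 2"
      using lim by (meson half_gt_zero lim_sequentially order_refl)
    have "\<forall>\<^sub>F \<sigma> in at_right 0. \<exists>x\<in>L. dist (\<sigma> *\<^sub>R x) (Y n) < e / 2"
      using Y[of n] half_gt_zero[OF \<open>e > 0\<close>] unfolding asymptotic_multiples_def by blast
    thus "\<forall>\<^sub>F \<sigma> in at_right 0. \<exists>x\<in>L. dist (\<sigma> *\<^sub>R x) l < e"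
    proof eventually_elim
      case (elim \<sigma>)
      thus ?case
        using n by (metis dist_commute dist_triangle_half_l)
    qed
  qed
qed

text \<open>The multiple \<open>n y\<close> with n = \<lfloor>1/\<sigma>\<rfloor> lies in
  \<open>L\<close>, and \<sigma>n differs from 1 by at most \<sigma>.\<close>

lemma subset_asymptotic_multiples:
  assumes zero: "0 \<in> L" and add: "\<And>x y. x \<in> L \<Longrightarrow> y \<in> L \<Longrightarrow> x + y \<in> L"
  shows "L \<subseteq> asymptotic_multiples L"
proof
  fix y assume y: "y \<in> L"
  have nat: "real n *\<^sub>R y \<in> L" for n
    by (induction n) (auto simp: zero scaleR_left_distrib intro: add y)
  show "y \<in> asymptotic_multiples L"
    unfolding asymptotic_multiples_def
  proof (intro CollectI allI impI)
    fix e :: real assume e: "e > 0"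
    \<comment> \<open>The error will be at most \<sigma> times \<open>norm y\<close>; the summand 1
      keeps the denominator positive when \<open>y = 0\<close>.\<close>
    define d where "d = e / (norm y + 1)"
    have d: "d > 0"
      using e by (simp add: d_def add_nonneg_pos)
    have "\<forall>\<^sub>F \<sigma> in at_right 0. 0 < \<sigma> \<and> \<sigma> < d"
      using d by (auto simp: eventually_at_right_field)
    thus "\<forall>\<^sub>F \<sigma> in at_right 0. \<exists>x\<in>L. dist (\<sigma> *\<^sub>R x) y < e"
    proof eventually_elim
      case (elim \<sigma>)
      define n where "n = nat \<lfloor>1 / \<sigma>\<rfloor>"
      have n: "real n = of_int \<lfloor>1 / \<sigma>\<rfloor>"
        using elim by (simp add: n_def)
      have "real n \<le> 1 / \<sigma>" "1 / \<sigma> < real n + 1"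
        unfolding n by linarith+
      hence "\<sigma> * real n \<le> 1" "1 < \<sigma> * real n + \<sigma>"
        using elim by (auto simp: field_simps)
      hence abs: "\<bar>\<sigma> * real n - 1\<bar> \<le> \<sigma>"
        by linarith
      have "dist (\<sigma> *\<^sub>R (real n *\<^sub>R y)) y = norm ((\<sigma> * real n - 1) *\<^sub>R y)"
        by (simp add: dist_norm scaleR_left_diff_distrib)
      also have "\<dots> \<le> \<sigma> * norm y"
        using abs by (simp add: mult_right_mono)
      also have "\<dots> \<le> \<sigma> * (norm y + 1)"
        using elim by (simp add: mult_left_mono)
      also have "\<dots> < d * (norm y + 1)"
        using elim by (intro mult_strict_right_mono) (auto simp: add_nonneg_pos)
      also have "\<dots> = e"
        using norm_ge_zero[of y] unfolding d_def by (simp add: add_nonneg_eq_0_iff)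
      finally show ?case
        using nat[of n] by blast
    qed
  qed
qed

text \<open>For a sum, add the two approximants found at a common \<sigma>. For a multiple by
  \<open>c > 0\<close>, the approximant of \<open>x\<close> at \<sigma>/\<open>c\<close> with
  tolerance \<open>e / c\<close> serves at \<sigma> with tolerance \<open>e\<close>.\<close>

lemma convex_cone_asymptotic_multiples:
  assumes zero: "0 \<in> L" and add: "\<And>x y. x \<in> L \<Longrightarrow> y \<in> L \<Longrightarrow> x + y \<in> L"
  shows "convex_cone (asymptotic_multiples L)"
  unfolding convex_cone_iff
proof (intro conjI ballI allI impI)
  show zero': "0 \<in> asymptotic_multiples L"
    using subset_asymptotic_multiples[of L] assms by blast
  fix x assume x: "x \<in> asymptotic_multiples L"
  {
    fix y assume y: "y \<in> asymptotic_multiples L"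
    show "x + y \<in> asymptotic_multiples L"
      unfolding asymptotic_multiples_def
    proof (intro CollectI allI impI)
      fix e :: real assume "e > 0"
      hence "e / 2 > 0"
        by simp
      hence "\<forall>\<^sub>F \<sigma> in at_right 0. \<exists>x'\<in>L. dist (\<sigma> *\<^sub>R x') x < e / 2"
        and "\<forall>\<^sub>F \<sigma> in at_right 0. \<exists>y'\<in>L. dist (\<sigma> *\<^sub>R y') y < e / 2"
        using x y unfolding asymptotic_multiples_def by blast+
      thus "\<forall>\<^sub>F \<sigma> in at_right 0. \<exists>z\<in>L. dist (\<sigma> *\<^sub>R z) (x + y) < e"
      proof eventually_elim
        case (elim \<sigma>)
        then obtain x' y' where *: "x' \<in> L" "y' \<in> L"
            "dist (\<sigma> *\<^sub>R x') x < e / 2" "dist (\<sigma> *\<^sub>R y') y < e / 2"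
          by blast
        hence "dist (\<sigma> *\<^sub>R (x' + y')) (x + y) < e"
          using dist_triangle_add[of "\<sigma> *\<^sub>R x'" "\<sigma> *\<^sub>R y'" x y] by (simp add: scaleR_right_distrib)
        thus ?case
          using add[OF *(1,2)] by blast
      qed
    qed
  next
    fix c :: real assume "c \<ge> 0"
    show "c *\<^sub>R x \<in> asymptotic_multiples L"
    proof (cases "c = 0")
      case True
      thus ?thesis using zero' by simp
    next
      case False
      hence c: "c > 0" using \<open>c \<ge> 0\<close> by simp
      show ?thesis
        unfolding asymptotic_multiples_def
      proof (intro CollectI allI impI)
        fix e :: real assume "e > 0"
        hence "e / c > 0"
          using c by simp
        hence "\<forall>\<^sub>F \<sigma> in at_right 0. \<exists>x'\<in>L. dist (\<sigma> *\<^sub>R x') x < e / c"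
          using x unfolding asymptotic_multiples_def by blast
        then obtain d where d: "d > 0"
            "\<And>\<sigma>. 0 < \<sigma> \<Longrightarrow> \<sigma> < d \<Longrightarrow> \<exists>x'\<in>L. dist (\<sigma> *\<^sub>R x') x < e / c"
          by (auto simp: eventually_at_right_field)
        have "\<exists>x'\<in>L. dist (\<sigma> *\<^sub>R x') (c *\<^sub>R x) < e" if \<sigma>: "0 < \<sigma>" "\<sigma> < c * d" for \<sigma>
        proof -
          obtain x' where x': "x' \<in> L" "dist ((\<sigma> / c) *\<^sub>R x') x < e / c"
            using d(2)[of "\<sigma> / c"] \<sigma> c by (auto simp: pos_divide_less_eq mult.commute)
          have "dist (\<sigma> *\<^sub>R x') (c *\<^sub>R x) = norm (c *\<^sub>R ((\<sigma> / c) *\<^sub>R x' - x))"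
            using c by (simp add: dist_norm scaleR_right_diff_distrib)
          also have "\<dots> = c * dist ((\<sigma> / c) *\<^sub>R x') x"
            using c by (simp add: dist_norm)
          also have "\<dots> < e"
            using x'(2) c by (simp add: field_simps)
          finally show ?thesis
            using x'(1) by blast
        qed
        moreover have "c * d > 0"
          using c d(1) by simp
        ultimately show "\<forall>\<^sub>F \<sigma> in at_right 0. \<exists>x'\<in>L. dist (\<sigma> *\<^sub>R x') (c *\<^sub>R x) < e"
          unfolding eventually_at_right_field by blast
      qed
    qed
  }
qed

section \<open>Tropicalization of multiplicative monoids\<close>

lemma vector_power_component [simp]: "(x ^ k) $ i = (x $ i) ^ k"
  for x :: "'a::monoid_mult ^ 'n::finite"
  by (induction k) auto

lemma log_vec_mult:
  assumes "x \<in> pos_orthant" "y \<in> pos_orthant"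
  shows "log_vec (x * y) = log_vec x + log_vec y"
  using assms by (simp add: log_vec_def pos_orthant_def vec_eq_iff ln_mult less_imp_neq[symmetric])

lemma log_vec_power:
  assumes "x \<in> pos_orthant"
  shows "log_vec (x ^ k) = real k *\<^sub>R log_vec x"
  using assms by (simp add: log_vec_def pos_orthant_def vec_eq_iff ln_realpow)

lemma zero_in_log_set: "1 \<in> S \<Longrightarrow> 0 \<in> log_set S"
  unfolding log_set_def
  by (rule image_eqI[of _ _ 1]) (auto simp: log_vec_def pos_orthant_def vec_eq_iff)

lemma add_in_log_set:
  assumes "\<And>x y. x \<in> S \<Longrightarrow> y \<in> S \<Longrightarrow> x * y \<in> S" "a \<in> log_set S" "b \<in> log_set S"
  shows "a + b \<in> log_set S"
proof -
  obtain x y where *: "x \<in> S" "x \<in> pos_orthant" "a = log_vec x"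
      "y \<in> S" "y \<in> pos_orthant" "b = log_vec y"
    using assms(2,3) by (auto simp: log_set_def)
  have "x * y \<in> S \<inter> pos_orthant"
    using * assms(1) by (auto simp: pos_orthant_def)
  thus ?thesis
    using * log_vec_mult[of x y] unfolding log_set_def by (metis imageI)
qed

lemma asymptotic_multiples_subset_trop: "asymptotic_multiples (log_set S) \<subseteq> trop S"
proof
  fix y assume y: "y \<in> asymptotic_multiples (log_set S)"
  have "\<exists>\<sigma> z. 0 < \<sigma> \<and> \<sigma> < inverse (real (Suc k)) \<and> z \<in> S \<inter> pos_orthant \<and>
          dist (\<sigma> *\<^sub>R log_vec z) y < inverse (real (Suc k))" for k
  proof -
    have "inverse (real (Suc k)) > 0"
      by simp
    hence "\<forall>\<^sub>F \<sigma> in at_right 0. \<exists>x\<in>log_set S. dist (\<sigma> *\<^sub>R x) y < inverse (real (Suc k))"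
      using y unfolding asymptotic_multiples_def by blast
    moreover have "\<forall>\<^sub>F \<sigma> in at_right 0. 0 < \<sigma> \<and> \<sigma> < inverse (real (Suc k))"
      unfolding eventually_at_right_field by (intro exI[of _ "inverse (real (Suc k))"]) auto
    ultimately have "\<forall>\<^sub>F \<sigma> in at_right 0. (0 < \<sigma> \<and> \<sigma> < inverse (real (Suc k))) \<and>
        (\<exists>x\<in>log_set S. dist (\<sigma> *\<^sub>R x) y < inverse (real (Suc k)))"
      by eventually_elim blast
    hence "\<exists>\<sigma>. (0 < \<sigma> \<and> \<sigma> < inverse (real (Suc k))) \<and>
        (\<exists>x\<in>log_set S. dist (\<sigma> *\<^sub>R x) y < inverse (real (Suc k)))"
      by (rule eventually_happens'[rotated]) simp
    thus ?thesis
      unfolding log_set_def by blast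
  qed
  then obtain \<sigma> Z where *: "\<And>k. 0 < \<sigma> k" "\<And>k. \<sigma> k < inverse (real (Suc k))"
      "\<And>k. Z k \<in> S \<inter> pos_orthant"
      "\<And>k. dist (\<sigma> k *\<^sub>R log_vec (Z k)) y < inverse (real (Suc k))"
    by metis
  have lim0: "(\<lambda>k. inverse (real (Suc k))) \<longlonglongrightarrow> 0"
    by (rule LIMSEQ_inverse_real_of_nat)
  have "\<sigma> \<longlonglongrightarrow> 0"
    by (rule tendsto_sandwich[OF _ _ tendsto_const lim0])
       (use * in \<open>auto intro!: always_eventually less_imp_le\<close>)
  hence "filterlim \<sigma> (at_right 0) sequentially"
    using *(1) by (auto simp: filterlim_at less_imp_neq[symmetric] intro!: always_eventually)
  hence "filterlim (\<lambda>k. inverse (\<sigma> k)) at_top sequentially"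
    by (rule filterlim_compose[OF filterlim_inverse_at_top_right])
  hence "filterlim (\<lambda>k. - inverse (\<sigma> k)) at_bot sequentially"
    by (simp add: filterlim_uminus_at_bot)
  \<comment> \<open>This sequence is the \<tau> required by \<open>trop\<close>: its values lie in
    (0,1), and -1/ln \<tau> recovers \<sigma>.\<close>
  hence "(\<lambda>k. exp (- inverse (\<sigma> k))) \<longlonglongrightarrow> 0"
    by (rule filterlim_compose[OF exp_at_bot])
  moreover have "(\<lambda>k. \<sigma> k *\<^sub>R log_vec (Z k)) \<longlonglongrightarrow> y"
    by (rule tendstoI, rule eventually_mono[OF order_tendstoD(2)[OF lim0]])
       (use *(4) less_trans in blast)+
  ultimately show "y \<in> trop S"
    unfolding trop_def
    using *(1,3)
    by (intro CollectI exI[of _ "\<lambda>k. exp (- inverse (\<sigma> k))"] exI[of _ Z])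
       (simp add: divide_inverse)
qed

text \<open>Since 0 < \<tau> < 1, the factor -1/ln \<tau> is nonnegative, so the approximating
  points already lie in the cone.\<close>

lemma trop_subset_closure_convex_cone_hull: "trop S \<subseteq> closure (convex_cone hull (log_set S))"
proof
  fix y assume "y \<in> trop S"
  then obtain \<tau> Y where *: "\<And>k. 0 < \<tau> k" "\<And>k. \<tau> k < (1::real)" "\<And>k. Y k \<in> S \<inter> pos_orthant"
      "(\<lambda>k. (- 1 / ln (\<tau> k)) *\<^sub>R log_vec (Y k)) \<longlonglongrightarrow> y"
    unfolding trop_def by blast
  have "(- 1 / ln (\<tau> k)) *\<^sub>R log_vec (Y k) \<in> convex_cone hull (log_set S)" for k
  proof (rule convex_cone_hull_mul)
    show "log_vec (Y k) \<in> convex_cone hull (log_set S)"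
      using *(3) by (auto simp: log_set_def intro!: hull_inc)
    show "0 \<le> - 1 / ln (\<tau> k)"
      using ln_less_zero[OF *(1,2), of k] by (simp add: divide_nonpos_neg)
  qed
  thus "y \<in> closure (convex_cone hull (log_set S))"
    unfolding closure_sequential using *(4)
    by (intro exI[of _ "\<lambda>k. (- 1 / ln (\<tau> k)) *\<^sub>R log_vec (Y k)"]) simp
qed

text \<open>For a monoid, \<open>asymptotic_multiples (log_set S)\<close> is a closed convex cone
  containing \<open>log_set S\<close>, so it fits between the closed conical hull and
  \<open>trop S\<close>.\<close>

lemma trop_eq_closure_convex_cone_hull:
  assumes "1 \<in> S" "\<And>x y. x \<in> S \<Longrightarrow> y \<in> S \<Longrightarrow> x * y \<in> S"
  shows "trop S = closure (convex_cone hull (log_set S))"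
proof
  have monoid: "0 \<in> log_set S" "\<And>a b. a \<in> log_set S \<Longrightarrow> b \<in> log_set S \<Longrightarrow> a + b \<in> log_set S"
    using zero_in_log_set add_in_log_set assms by blast+
  have "convex_cone hull (log_set S) \<subseteq> asymptotic_multiples (log_set S)"
    by (intro hull_minimal subset_asymptotic_multiples convex_cone_asymptotic_multiples monoid)
  hence "closure (convex_cone hull (log_set S)) \<subseteq> asymptotic_multiples (log_set S)"
    by (intro closure_minimal closed_asymptotic_multiples)
  thus "closure (convex_cone hull (log_set S)) \<subseteq> trop S"
    using asymptotic_multiples_subset_trop by blast
qed (rule trop_subset_closure_convex_cone_hull)

text \<open>Logarithms of numbers in (0,1] are nonpositive, and the nonpositive orthant is closed
  and convex.\<close>

lemma closure_convex_hull_log_set_nonpos: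
  assumes "\<And>x i. x \<in> S \<Longrightarrow> x $ i \<le> 1"
  shows "closure (convex hull (log_set S)) \<subseteq> {y. \<forall>i. y $ i \<le> 0}"
proof (intro closure_minimal hull_minimal)
  show "log_set S \<subseteq> {y. \<forall>i. y $ i \<le> 0}"
    using assms by (auto simp: log_set_def log_vec_def pos_orthant_def)
  show "convex {y :: real ^ 'n. \<forall>i. y $ i \<le> 0}"
    by (auto intro!: convexI add_nonpos_nonpos mult_nonneg_nonpos)
  show "closed {y :: real ^ 'n. \<forall>i. y $ i \<le> 0}"
    by (intro closed_Collect_all closed_Collect_le continuous_intros)
qed

text \<open>Coordinates of \<open>v\<close> are at most 1, so multiplying \<open>w\<close> by powers
  of \<open>v\<close> never leaves the ball. At \<open>log_vec (v ^ k * w)\<close> the functional is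
  affine in \<open>k\<close> with slope \<open>c \<bullet> y\<close>; a negative slope would make it
  negative for large \<open>k\<close>. In the application \<open>c\<close> is
  \<open>a - b\<close>.\<close>

lemma inner_nonneg_log_set_of_ball:
  assumes mult: "\<And>x y. x \<in> S \<Longrightarrow> y \<in> S \<Longrightarrow> x * y \<in> S"
    and le1: "\<And>x i. x \<in> S \<Longrightarrow> x $ i \<le> 1"
    and w: "w \<in> S" "w \<in> pos_orthant" "norm w < \<epsilon>"
    and ineq: "\<And>y. y \<in> log_set (S \<inter> ball 0 \<epsilon>) \<Longrightarrow> c \<bullet> y \<ge> 0"
    and y: "y \<in> log_set S"
  shows "c \<bullet> y \<ge> 0"
proof (rule ccontr)
  assume neg: "\<not> c \<bullet> y \<ge> 0"
  obtain v where v: "v \<in> S" "v \<in> pos_orthant" "y = log_vec v"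
    using y by (auto simp: log_set_def)
  have *: "c \<bullet> (real k *\<^sub>R y + log_vec w) \<ge> 0" for k
  proof -
    have vk: "v ^ k \<in> pos_orthant"
      using v(2) by (simp add: pos_orthant_def)
    have "v ^ k * w \<in> S"
      by (induction k) (auto simp: w mult.assoc intro: mult v)
    moreover have "v ^ k * w \<in> pos_orthant"
      using vk w(2) by (simp add: pos_orthant_def)
    moreover have "norm (v ^ k * w) \<le> norm w"
    proof (rule norm_le_componentwise_cart)
      fix i
      have "0 < v $ i" "v $ i \<le> 1" "0 < w $ i"
        using v w le1 by (auto simp: pos_orthant_def)
      hence "(v $ i) ^ k * (w $ i) \<le> 1 * (w $ i)"
        by (intro mult_right_mono power_le_one) auto
      thus "norm ((v ^ k * w) $ i) \<le> norm (w $ i)"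
        using \<open>0 < v $ i\<close> \<open>0 < w $ i\<close> by simp
    qed
    ultimately have "log_vec (v ^ k * w) \<in> log_set (S \<inter> ball 0 \<epsilon>)"
      using w(3) by (auto simp: log_set_def)
    thus ?thesis
      using ineq log_vec_mult[OF vk w(2)] log_vec_power[OF v(2)] v(3) by metis
  qed
  \<comment> \<open>The quotient is the zero of the affine function of \<open>k\<close>.\<close>
  obtain k where k: "(c \<bullet> log_vec w) / (- (c \<bullet> y)) < real k"
    using reals_Archimedean2 by blast
  hence "c \<bullet> (real k *\<^sub>R y + log_vec w) < 0"
    using neg by (simp add: inner_add_right field_simps)
  thus False
    using *[of k] by linarith
qed

section \<open>Densities in complete graphs and tensor products\<close>

lemma pair_graphI:
  assumes "finite (pverts G)" "parcs G \<subseteq> pverts G \<times> pverts G" "sym (parcs G)" "irrefl (parcs G)"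
  shows "pair_graph G"
proof unfold_locales
  show "finite (parcs G)"
    using assms(1,2) by (meson finite_SigmaI finite_subset)
qed (use assms in \<open>auto simp: symmetric_def irrefl_def\<close>)

lemma pair_graphD:
  assumes "pair_graph G"
  shows "finite (pverts G)" "parcs G \<subseteq> pverts G \<times> pverts G" "sym (parcs G)" "irrefl (parcs G)"
proof -
  interpret pair_graph G by fact
  show "finite (pverts G)" "parcs G \<subseteq> pverts G \<times> pverts G" "sym (parcs G)" "irrefl (parcs G)"
    using pair_finite_verts pair_sym_arcs pair_no_loops
    by (force simp: symmetric_def irrefl_def dest: in_arcsD1 in_arcsD2)+
qed

lemma graph_homs_subset: "graph_homs H G \<subseteq> pverts H \<rightarrow>\<^sub>E pverts G"
  by (auto simp: graph_homs_def)

lemma hom_density_le_1: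
  assumes "finite (pverts H)" "finite (pverts G)"
  shows "hom_density H G \<le> 1"
proof -
  have "card (graph_homs H G) \<le> card (pverts H \<rightarrow>\<^sub>E pverts G)"
    using assms by (intro card_mono graph_homs_subset finite_PiE) auto
  thus ?thesis
    \<comment> \<open>If there are no maps at all, the quotient is 0/0 = 0 and the bound still
      holds.\<close>
    by (auto simp: hom_density_def divide_le_eq_1)
qed

lemma card_maps_pos:
  assumes "finite V" "finite W" "W \<noteq> {}"
  shows "card (V \<rightarrow>\<^sub>E W) > 0"
  using assms by (simp add: card_funcsetE card_gt_0_iff)

lemma hom_density_no_arcs:
  assumes "finite (pverts H)" "finite (pverts G)" "pverts G \<noteq> {}" "parcs H = {}"
  shows "hom_density H G = 1"
  using card_maps_pos[OF assms(1-3)] assms(4) by (simp add: hom_density_def graph_homs_def)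

text \<open>A constant map would send an arc of \<open>H\<close> to a loop, so it is not a
  homomorphism.\<close>

lemma hom_density_less_1:
  assumes H: "pair_graph H" "parcs H \<noteq> {}" and G: "pair_graph G" "pverts G \<noteq> {}"
  shows "hom_density H G < 1"
proof -
  obtain x u v where x: "x \<in> pverts G" and uv: "(u, v) \<in> parcs H"
    using assms by fastforce
  have "u \<in> pverts H" "v \<in> pverts H"
    using pair_graphD(2)[OF H(1)] uv by auto
  moreover have "(x, x) \<notin> parcs G"
    using pair_graphD(4)[OF G(1)] by (auto simp: irrefl_def)
  ultimately have "(\<lambda>z\<in>pverts H. x) \<notin> graph_homs H G"
    using uv by (force simp: graph_homs_def)
  moreover have "(\<lambda>z\<in>pverts H. x) \<in> pverts H \<rightarrow>\<^sub>E pverts G"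
    using x by simp
  ultimately have "graph_homs H G \<subset> pverts H \<rightarrow>\<^sub>E pverts G"
    using graph_homs_subset by blast
  hence "card (graph_homs H G) < card (pverts H \<rightarrow>\<^sub>E pverts G)"
    using pair_graphD(1)[OF H(1)] pair_graphD(1)[OF G(1)]
    by (intro psubset_card_mono finite_PiE) auto
  thus ?thesis
    by (simp add: hom_density_def divide_less_eq_1)
qed

lemma hom_density_no_target_arcs:
  assumes "parcs H \<noteq> {}" "parcs G = {}"
  shows "hom_density H G = 0"
proof -
  have "graph_homs H G = {}"
    using assms by (auto simp: graph_homs_def)
  thus ?thesis
    by (simp add: hom_density_def)
qed

definition clique :: "nat \<Rightarrow> nat pair_pre_digraph" where
  "clique n = \<lparr>pverts = {..<n}, parcs = {(i, j). i < n \<and> j < n \<and> i \<noteq> j}\<rparr>"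

lemma pverts_clique [simp]: "pverts (clique n) = {..<n}"
  by (simp add: clique_def)

lemma pair_graph_clique: "pair_graph (clique n)"
  by (rule pair_graphI) (auto simp: clique_def sym_def irrefl_def)

text \<open>Every injective map into a clique is a homomorphism because \<open>H\<close> has no
  loops. The proportion of injective maps is a falling factorial over a power, a product of fixed
  length whose factors tend to 1.\<close>

lemma hom_density_clique_tendsto_1:
  assumes "pair_graph H"
  shows "(\<lambda>n. hom_density H (clique n)) \<longlonglongrightarrow> 1"
proof (rule tendsto_sandwich)
  note H = pair_graphD[OF assms]
  let ?k = "card (pverts H)"
  let ?p = "\<lambda>n. \<Prod>i = 0..<?k. (real n - real i) / real n"
  have "?p n \<le> hom_density H (clique n)" if n: "n \<ge> ?k" for n
  proof -
    have "{f \<in> pverts H \<rightarrow>\<^sub>E {..<n}. inj_on f (pverts H)} \<subseteq> graph_homs H (clique n)"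
    proof
      fix f assume f: "f \<in> {f \<in> pverts H \<rightarrow>\<^sub>E {..<n}. inj_on f (pverts H)}"
      have "f u \<noteq> f v" "f u < n" "f v < n" if "(u, v) \<in> parcs H" for u v
        using that f H(2,4) by (auto simp: irrefl_def inj_on_def PiE_def Pi_def) blast
      thus "f \<in> graph_homs H (clique n)"
        using f by (auto simp: graph_homs_def clique_def)
    qed
    moreover have "finite (graph_homs H (clique n))"
      using H(1) by (intro finite_subset[OF graph_homs_subset] finite_PiE) auto
    ultimately have "card {f \<in> pverts H \<rightarrow>\<^sub>E {..<n}. inj_on f (pverts H)}
        \<le> card (graph_homs H (clique n))"
      by (rule card_mono[rotated])
    hence "(\<Prod>i = 0..<?k. n - i) \<le> card (graph_homs H (clique n))"
      using card_inj_on_subset_funcset[OF H(1) finite_lessThan[of n] subset_refl] by simp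
    hence "real (\<Prod>i = 0..<?k. n - i) \<le> real (card (graph_homs H (clique n)))"
      by (rule of_nat_mono)
    \<comment> \<open>The bound \<open>n \<ge> ?k\<close> keeps the truncated subtraction on
      \<open>nat\<close> exact.\<close>
    moreover have "real (\<Prod>i = 0..<?k. n - i) = (\<Prod>i = 0..<?k. real n - real i)"
      unfolding of_nat_prod using n by (intro prod.cong) auto
    ultimately show ?thesis
      using H(1) by (simp add: hom_density_def card_funcsetE prod_dividef divide_right_mono)
  qed
  thus "\<forall>\<^sub>F n in sequentially. ?p n \<le> hom_density H (clique n)"
    by (auto simp: eventually_sequentially)
  show "\<forall>\<^sub>F n in sequentially. hom_density H (clique n) \<le> 1"
    using H(1) by (auto intro!: always_eventually hom_density_le_1)
  have "(\<lambda>n. (real n - real i) / real n) \<longlonglongrightarrow> 1" for i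
  proof -
    have "(\<lambda>n. 1 - real i / real n) \<longlonglongrightarrow> 1 - 0"
      by (intro tendsto_intros lim_const_over_n)
    moreover have "\<forall>\<^sub>F n in sequentially. 1 - real i / real n = (real n - real i) / real n"
      using eventually_gt_at_top[of 0] by eventually_elim (simp add: field_simps)
    ultimately show ?thesis
      using Lim_transform_eventually by fastforce
  qed
  hence "?p \<longlonglongrightarrow> (\<Prod>i = 0..<?k. 1)"
    by (intro tendsto_prod)
  thus "?p \<longlonglongrightarrow> 1"
    by simp
qed simp

text \<open>The categorical product of graphs. Pairs of vertices are encoded as numbers because
  \<open>graph_profile\<close> ranges over graphs on \<open>nat\<close>.\<close>

definition tensor_graph ::
    "nat pair_pre_digraph \<Rightarrow> nat pair_pre_digraph \<Rightarrow> nat pair_pre_digraph" where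
  "tensor_graph G G' =
     \<lparr>pverts = prod_encode ` (pverts G \<times> pverts G'),
      parcs = {(prod_encode (a, a'), prod_encode (b, b')) | a a' b b'.
                 (a, b) \<in> parcs G \<and> (a', b') \<in> parcs G'}\<rparr>"

lemma pair_graph_tensor_graph:
  assumes "pair_graph G" "pair_graph G'"
  shows "pair_graph (tensor_graph G G')"
proof (rule pair_graphI)
  note G = pair_graphD[OF assms(1)] and G' = pair_graphD[OF assms(2)]
  show "finite (pverts (tensor_graph G G'))"
    using G(1) G'(1) by (simp add: tensor_graph_def)
  show "parcs (tensor_graph G G') \<subseteq> pverts (tensor_graph G G') \<times> pverts (tensor_graph G G')"
    using G(2) G'(2) by (auto simp: tensor_graph_def)
  show "sym (parcs (tensor_graph G G'))"
    unfolding tensor_graph_def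
    by (rule symI) (use symD[OF G(3)] symD[OF G'(3)] in auto)
  show "irrefl (parcs (tensor_graph G G'))"
    using G(4) by (auto simp: tensor_graph_def irrefl_def)
qed

text \<open>The universal property of the categorical product: a homomorphism into it amounts to a
  pair of homomorphisms into the factors, recovered by the two projections.\<close>

lemma card_graph_homs_tensor_graph:
  assumes "parcs H \<subseteq> pverts H \<times> pverts H"
  shows "card (graph_homs H (tensor_graph G G')) =
    card (graph_homs H G) * card (graph_homs H G')"
proof -
  let ?F = "\<lambda>(f, g). \<lambda>x\<in>pverts H. prod_encode (f x, g x)"
  have "bij_betw ?F (graph_homs H G \<times> graph_homs H G') (graph_homs H (tensor_graph G G'))"
  proof (rule bij_betwI')
    fix p q
    assume "p \<in> graph_homs H G \<times> graph_homs H G'" "q \<in> graph_homs H G \<times> graph_homs H G'"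
    then obtain f g f' g' where pq: "p = (f, g)" "q = (f', g')"
        "f \<in> extensional (pverts H)" "f' \<in> extensional (pverts H)"
        "g \<in> extensional (pverts H)" "g' \<in> extensional (pverts H)"
      using graph_homs_subset[of H] by (auto simp: PiE_def) blast
    show "?F p = ?F q \<longleftrightarrow> p = q"
    proof
      assume eq: "?F p = ?F q"
      have "f x = f' x \<and> g x = g' x" if "x \<in> pverts H" for x
        using fun_cong[OF eq, of x] that pq(1,2) by simp
      thus "p = q"
        using pq by (auto intro: extensionalityI)
    qed simp
  next
    fix p assume "p \<in> graph_homs H G \<times> graph_homs H G'"
    thus "?F p \<in> graph_homs H (tensor_graph G G')"
      using assms by (fastforce simp: graph_homs_def tensor_graph_def)
  next
    fix h assume h: "h \<in> graph_homs H (tensor_graph G G')"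
    define f where "f = (\<lambda>x\<in>pverts H. fst (prod_decode (h x)))"
    define g where "g = (\<lambda>x\<in>pverts H. snd (prod_decode (h x)))"
    have hV: "h \<in> pverts H \<rightarrow>\<^sub>E prod_encode ` (pverts G \<times> pverts G')"
      using h by (auto simp: graph_homs_def tensor_graph_def)
    have "f x \<in> pverts G \<and> g x \<in> pverts G'" if "x \<in> pverts H" for x
      using PiE_mem[OF hV that] that by (auto simp: f_def g_def)
    moreover have "(f u, f v) \<in> parcs G \<and> (g u, g v) \<in> parcs G'" if "(u, v) \<in> parcs H" for u v
    proof -
      have "u \<in> pverts H" "v \<in> pverts H" "(h u, h v) \<in> parcs (tensor_graph G G')"
        using that assms h by (auto simp: graph_homs_def)
      thus ?thesis
        by (auto simp: f_def g_def tensor_graph_def)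
    qed
    moreover have "f \<in> extensional (pverts H)" "g \<in> extensional (pverts H)"
      by (simp_all add: f_def g_def)
    ultimately have "(f, g) \<in> graph_homs H G \<times> graph_homs H G'"
      by (auto simp: graph_homs_def PiE_def)
    moreover have "h = ?F (f, g)"
    proof
      fix x
      \<comment> \<open>Off \<open>pverts H\<close> both sides are \<open>undefined\<close>, since
        \<open>h\<close> is extensional.\<close>
      show "h x = ?F (f, g) x"
        using PiE_arb[OF hV, of x] by (simp add: f_def g_def)
    qed
    ultimately show "\<exists>p\<in>graph_homs H G \<times> graph_homs H G'. h = ?F p"
      by blast
  qed
  thus ?thesis
    by (simp add: bij_betw_same_card[symmetric] card_cartesian_product)
qed

lemma hom_density_tensor_graph:
  assumes "pair_graph H"
  shows "hom_density H (tensor_graph G G') = hom_density H G * hom_density H G'"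
proof -
  note H = pair_graphD[OF assms]
  have "card (pverts (tensor_graph G G')) = card (pverts G) * card (pverts G')"
    by (simp add: tensor_graph_def card_image inj_prod_encode card_cartesian_product)
  thus ?thesis
    using H(1) by (simp add: hom_density_def card_graph_homs_tensor_graph[OF H(2)]
        card_funcsetE power_mult_distrib)
qed

section \<open>The graph profile\<close>

definition density_vec :: "('n::finite \<Rightarrow> 'a pair_pre_digraph) \<Rightarrow> nat pair_pre_digraph \<Rightarrow> real ^ 'n"
  where "density_vec C G = (\<chi> i. hom_density (C i) G)"

lemma graph_profile_eq:
  "graph_profile C = closure (density_vec C ` {G. pair_graph G \<and> pverts G \<noteq> {}})"
  unfolding graph_profile_def density_vec_def by (rule arg_cong[of _ _ closure]) auto

lemma density_vec_in_graph_profile: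
  "pair_graph G \<Longrightarrow> pverts G \<noteq> {} \<Longrightarrow> density_vec C G \<in> graph_profile C"
  unfolding graph_profile_eq by (rule subsetD[OF closure_subset]) auto

text \<open>A closed condition on a coordinate passes from density vectors to their limits.\<close>

lemma graph_profile_le_1:
  fixes C :: "'n::finite \<Rightarrow> 'a pair_pre_digraph"
  assumes "\<And>i. pair_graph (C i)" "x \<in> graph_profile C"
  shows "x $ i \<le> 1"
proof -
  have "graph_profile C \<subseteq> {x. x $ i \<le> 1}"
    unfolding graph_profile_eq
  proof (rule closure_minimal)
    show "closed {x :: real ^ 'n. x $ i \<le> 1}"
      by (intro closed_Collect_le continuous_intros)
  qed (auto simp: density_vec_def pair_graphD(1) assms(1) hom_density_le_1)
  thus ?thesis
    using assms(2) by auto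
qed

lemma graph_profile_no_arcs:
  fixes C :: "'n::finite \<Rightarrow> 'a pair_pre_digraph"
  assumes "\<And>i. pair_graph (C i)" "parcs (C i) = {}" "x \<in> graph_profile C"
  shows "x $ i = 1"
proof -
  have "graph_profile C \<subseteq> {x. x $ i = 1}"
    unfolding graph_profile_eq
  proof (rule closure_minimal)
    show "closed {x :: real ^ 'n. x $ i = 1}"
      by (intro closed_Collect_eq continuous_intros)
    show "density_vec C ` {G. pair_graph G \<and> pverts G \<noteq> {}} \<subseteq> {x. x $ i = 1}"
      using hom_density_no_arcs[OF pair_graphD(1)[OF assms(1)] _ _ assms(2)] pair_graphD(1)
      unfolding density_vec_def by fastforce
  qed
  thus ?thesis
    using assms(3) by auto
qed

lemma density_vec_clique_tendsto_1:
  assumes "\<And>i. pair_graph (C i)"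
  shows "(\<lambda>n. density_vec C (clique n)) \<longlonglongrightarrow> 1"
  by (rule vec_tendstoI) (simp add: density_vec_def hom_density_clique_tendsto_1 assms)

text \<open>As soon as some \<open>C i\<close> has an arc, no single graph attains this vector; it
  arises as a limit over cliques.\<close>

lemma one_in_graph_profile:
  assumes "\<And>i. pair_graph (C i)"
  shows "1 \<in> graph_profile C"
proof -
  have "closed (graph_profile C)"
    by (simp add: graph_profile_def)
  \<comment> \<open>The shift avoids \<open>clique 0\<close>, which has no vertices.\<close>
  moreover have "density_vec C (clique (Suc n)) \<in> graph_profile C" for n
    by (rule density_vec_in_graph_profile) (auto simp: pair_graph_clique)
  moreover have "(\<lambda>n. density_vec C (clique (Suc n))) \<longlonglongrightarrow> 1"
    using density_vec_clique_tendsto_1[OF assms] by (rule LIMSEQ_Suc)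
  ultimately show ?thesis
    by (rule closed_sequentially)
qed

text \<open>Tensor products realise coordinatewise products of density vectors, and multiplication
  is continuous, so the property survives the closure.\<close>

lemma mult_in_graph_profile:
  assumes C: "\<And>i. pair_graph (C i)" and xy: "x \<in> graph_profile C" "y \<in> graph_profile C"
  shows "x * y \<in> graph_profile C"
proof -
  let ?D = "density_vec C ` {G. pair_graph G \<and> pverts G \<noteq> {}}"
  obtain X Y where XY: "\<And>n. X n \<in> ?D" "X \<longlonglongrightarrow> x" "\<And>n. Y n \<in> ?D" "Y \<longlonglongrightarrow> y"
    using xy unfolding graph_profile_eq closure_sequential by blast
  have "X n * Y n \<in> ?D" for n
  proof -
    obtain G G' where G: "X n = density_vec C G" "Y n = density_vec C G'"
        "pair_graph G" "pverts G \<noteq> {}" "pair_graph G'" "pverts G' \<noteq> {}"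
      using XY(1)[of n] XY(3)[of n] by auto
    show ?thesis
    proof (rule image_eqI)
      show "X n * Y n = density_vec C (tensor_graph G G')"
        using G by (simp add: density_vec_def vec_eq_iff hom_density_tensor_graph C)
      show "tensor_graph G G' \<in> {G. pair_graph G \<and> pverts G \<noteq> {}}"
        using G pair_graph_tensor_graph by (auto simp: tensor_graph_def)
    qed
  qed
  moreover have "(\<lambda>n. X n * Y n) \<longlonglongrightarrow> x * y"
    by (rule vec_tendstoI) (auto intro!: tendsto_mult tendsto_vec_nth XY)
  ultimately show ?thesis
    unfolding graph_profile_eq closure_sequential by (intro exI[of _ "\<lambda>n. X n * Y n"]) simp
qed

text \<open>
  Coordinates of edgeless graphs are constantly 1, so the powers of the density vector of a large
  clique converge to a vector of least norm in the profile.
\<close>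

lemma graph_profile_positive_in_ball:
  fixes C :: "'n::finite \<Rightarrow> 'a pair_pre_digraph"
  assumes C: "\<And>i. pair_graph (C i)" and p: "p \<in> graph_profile C" "norm p < \<epsilon>"
  obtains w where "w \<in> graph_profile C" "w \<in> pos_orthant" "norm w < \<epsilon>"
proof -
  \<comment> \<open>All densities in a large clique are close to 1, hence positive; positivity then
    carries over to powers.\<close>
  have "\<forall>\<^sub>F n in sequentially. \<forall>i. hom_density (C i) (clique n) > 0"
    by (intro eventually_all_finite order_tendstoD(1)[OF hom_density_clique_tendsto_1] C) simp
  hence "\<forall>\<^sub>F n in sequentially. (\<forall>i. hom_density (C i) (clique n) > 0) \<and> n > 0"
    using eventually_gt_at_top eventually_conj by blast
  then obtain n where n: "\<And>i. hom_density (C i) (clique n) > 0" "n > 0"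
    using eventually_happens'[OF sequentially_bot] by blast
  define v where "v = density_vec C (clique n)"
  define l :: "real ^ 'n" where "l = (\<chi> i. if parcs (C i) = {} then 1 else 0)"
  have ne: "pverts (clique n) \<noteq> {}"
    using n(2) by auto
  have v: "v \<in> graph_profile C"
    unfolding v_def by (intro density_vec_in_graph_profile pair_graph_clique ne)
  have "(\<lambda>k. v ^ k) \<longlonglongrightarrow> l"
  proof (rule vec_tendstoI)
    fix i
    show "(\<lambda>k. (v ^ k) $ i) \<longlonglongrightarrow> l $ i"
    proof (cases "parcs (C i) = {}")
      case True
      thus ?thesis
        using graph_profile_no_arcs[OF C True v] by (simp add: l_def)
    next
      case False
      have "0 \<le> v $ i" "v $ i < 1"
        using n(1)[of i] hom_density_less_1[OF C False pair_graph_clique ne]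
        by (auto simp: v_def density_vec_def)
      thus ?thesis
        using False by (simp add: l_def LIMSEQ_realpow_zero)
    qed
  qed
  hence "(\<lambda>k. norm (v ^ k)) \<longlonglongrightarrow> norm l"
    by (rule tendsto_norm)
  \<comment> \<open>Where \<open>C i\<close> has no arcs both vectors have coordinate 1; elsewhere
    \<open>l\<close> vanishes.\<close>
  moreover have "norm l \<le> norm p"
    by (rule norm_le_componentwise_cart)
       (simp add: l_def graph_profile_no_arcs[OF C _ p(1)])
  ultimately have "\<forall>\<^sub>F k in sequentially. norm (v ^ k) < \<epsilon>"
    using p(2) order_tendstoD(2) by (metis le_less_trans)
  then obtain k where k: "norm (v ^ k) < \<epsilon>"
    using eventually_happens'[OF sequentially_bot] by blast
  show thesis
  proof
    show "v ^ k \<in> graph_profile C"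
      by (induction k) (auto intro: one_in_graph_profile mult_in_graph_profile C v)
    show "v ^ k \<in> pos_orthant"
      using n(1) by (simp add: pos_orthant_def v_def density_vec_def)
  qed fact
qed

text \<open>The one-vertex graph has no arcs to receive those of \<open>C i\<close>, so the origin
  itself is a density vector.\<close>

lemma zero_in_graph_profile:
  assumes "\<And>i. parcs (C i) \<noteq> {}"
  shows "0 \<in> graph_profile C"
proof -
  define G :: "nat pair_pre_digraph" where "G = \<lparr>pverts = {0}, parcs = {}\<rparr>"
  have "pair_graph G"
    by (rule pair_graphI) (auto simp: G_def sym_def irrefl_def)
  hence "density_vec C G \<in> graph_profile C"
    by (rule density_vec_in_graph_profile) (simp add: G_def)
  moreover have "density_vec C G = 0"
    using assms by (simp add: density_vec_def vec_eq_iff hom_density_no_target_arcs G_def)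
  ultimately show ?thesis
    by simp
qed

text \<open>An edgeless \<open>C i\<close>, such as a single vertex, has constant density 1, and
  then the profile misses every ball of radius at most 1. Hence nonemptiness is claimed when every
  \<open>C i\<close> has an arc, and the equivalence whenever the intersection is nonempty.\<close>

theorem theorem2p4:
  fixes C :: "'n::finite \<Rightarrow> 'a pair_pre_digraph"
  assumes "\<And>i. pair_graph (C i)"
    and "\<And>i. Digraph_Component.connected (with_proj (C i))"
  shows "trop (graph_profile C) = closure (convex_cone hull (log_set (graph_profile C)))
    \<and> closure (convex_cone hull (log_set (graph_profile C)))
        = closure (convex hull (log_set (graph_profile C)))
    \<and> closure (convex hull (log_set (graph_profile C))) \<subseteq> {y. \<forall>i. y $ i \<le> 0}
    \<and> (\<forall>\<epsilon>>0.
         ((\<forall>i. parcs (C i) \<noteq> {}) \<longrightarrow> graph_profile C \<inter> ball 0 \<epsilon> \<noteq> {})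
         \<and> (graph_profile C \<inter> ball 0 \<epsilon> \<noteq> {} \<longrightarrow>
              (\<forall>a b :: real ^ 'n.
                 (\<forall>y \<in> trop (graph_profile C). a \<bullet> y \<ge> b \<bullet> y)
                 \<longleftrightarrow> (\<forall>y \<in> log_set (graph_profile C \<inter> ball 0 \<epsilon>). a \<bullet> y \<ge> b \<bullet> y))))"
proof -
  let ?S = "graph_profile C"
  note C = assms(1)
  have mult: "x * y \<in> ?S" if "x \<in> ?S" "y \<in> ?S" for x y
    using that by (rule mult_in_graph_profile[OF C])
  have le1: "x $ i \<le> 1" if "x \<in> ?S" for x i
    using graph_profile_le_1[OF C that] .
  have one: "1 \<in> ?S"
    by (rule one_in_graph_profile[OF C])
  have trop: "trop ?S = closure (convex_cone hull (log_set ?S))"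
    by (rule trop_eq_closure_convex_cone_hull[OF one mult])
  have conv: "convex_cone hull (log_set ?S) = convex hull (log_set ?S)"
    by (intro convex_cone_hull_eq_convex_hull zero_in_log_set one add_in_log_set mult)
  have log_subset: "log_set ?S \<subseteq> trop ?S"
    unfolding trop by (meson closure_subset hull_subset subset_trans)
  have iff: "(\<forall>y\<in>trop ?S. a \<bullet> y \<ge> b \<bullet> y) \<longleftrightarrow> (\<forall>y\<in>log_set (?S \<inter> ball 0 \<epsilon>). a \<bullet> y \<ge> b \<bullet> y)"
    if ne: "?S \<inter> ball 0 \<epsilon> \<noteq> {}" for \<epsilon> and a b :: "real ^ 'n"
  proof
    assume "\<forall>y\<in>trop ?S. a \<bullet> y \<ge> b \<bullet> y"
    moreover have "log_set (?S \<inter> ball 0 \<epsilon>) \<subseteq> log_set ?S"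
      by (auto simp: log_set_def)
    ultimately show "\<forall>y\<in>log_set (?S \<inter> ball 0 \<epsilon>). a \<bullet> y \<ge> b \<bullet> y"
      using log_subset by blast
  next
    assume ball: "\<forall>y\<in>log_set (?S \<inter> ball 0 \<epsilon>). a \<bullet> y \<ge> b \<bullet> y"
    obtain p where "p \<in> ?S" "norm p < \<epsilon>"
      using ne by auto
    then obtain w where w: "w \<in> ?S" "w \<in> pos_orthant" "norm w < \<epsilon>"
      using graph_profile_positive_in_ball[of C, OF C] by blast
    have "(a - b) \<bullet> y \<ge> 0" if "y \<in> log_set ?S" for y
      by (rule inner_nonneg_log_set_of_ball[OF mult le1 w _ that])
         (use ball in \<open>auto simp: inner_diff_left\<close>)
    \<comment> \<open>A half-space through the origin is a closed convex cone, so the inequality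
      extends from \<open>log_set ?S\<close> to its closed conical hull, which is
      \<open>trop ?S\<close>.\<close>
    hence "convex_cone hull (log_set ?S) \<subseteq> {y. (a - b) \<bullet> y \<ge> 0}"
      by (intro hull_minimal convex_cone_halfspace_ge) auto
    hence "trop ?S \<subseteq> {y. (a - b) \<bullet> y \<ge> 0}"
      unfolding trop by (intro closure_minimal closed_halfspace_ge)
    thus "\<forall>y\<in>trop ?S. a \<bullet> y \<ge> b \<bullet> y"
      by (auto simp: inner_diff_left)
  qed
  have "?S \<inter> ball 0 \<epsilon> \<noteq> {}" if "\<epsilon> > 0" "\<forall>i. parcs (C i) \<noteq> {}" for \<epsilon>
    using zero_in_graph_profile[of C] that by auto
  thus ?thesis
    using trop conv iff closure_convex_hull_log_set_nonpos[of ?S, OF le1] by simp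
qed

end
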